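(* Let $\ell$ be a line in $\mathbb{P}^n$ such that $\ell\cap\Delta_{n-2}=\emptyset$, and let $\mathbb{X}\subseteq\ell$ be a set of $m>n$ points such that $\mathbb{X}\cap\Delta_{n-1}=\emptyset$. If there exist two distinct points $P=[p_0:\dots:p_n]$ and $Q=[q_0:\dots:q_n]$ on $\ell$ such that $$\det\begin{bmatrix} p_0^{n-1}&\cdots&p_n^{n-1}\\ p_0^{n-2}q_0&\cdots&p_n^{n-2}q_n\\ \vdots&&\vdots\\ q_0^{n-1}&\cdots&q_n^{n-1}\\ p_0&\cdots&p_n\end{bmatrix}=\det\begin{bmatrix} p_0^{n-1}&\cdots&p_n^{n-1}\\ p_0^{n-2}q_0&\cdots&p_n^{n-2}q_n\\ \vdots&&\vdots\\ q_0^{n-1}&\cdots&q_n^{n-1}\\ q_0&\cdots&q_n\end{bmatrix}=0,$$ where in each matrix the first $n$ rows are $(p_0^{n-1-k}q_0^{k},\dots,p_n^{n-1-k}q_n^{k})$ for $k=0,\dots,n-1$, then $\mathbb{X}^{\underline{\star}n}$ is a Hadamard star configuration (of codimension $n$).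
   Context: Work over $\mathbb{C}$; $S=\mathbb{C}[x_0,\dots,x_n]$ is the coordinate ring of $\mathbb{P}^n$, and $S_1$ is the space of linear forms. $\Delta_i=\bigcup_{0\le j_1<\dots<j_{n-i}\le n}V(x_{j_1})\cap\dots\cap V(x_{j_{n-i}})$, i.e. the set of points with at most $i+1$ nonzero coordinates. So $\Delta_{n-1}$ is the set of points with at least one zero coordinate and $\Delta_{n-2}$ the set of points with at least two zero coordinates. Hadamard product: for points $A=[a_0:\dots:a_n]$, $B=[b_0:\dots:b_n]$ with $a_ib_i\ne0$ for some $i$, $A\star B=[a_0b_0:\dots:a_nb_n]$ (otherwise it is not defined). For a point $P$ and a variety $X$, $P\star X$ is the closure of $\{P\star Q: Q\in X,\ P\star Q\text{ defined}\}$. For a finite set of points $\mathbb{X}\subset\mathbb{P}^n$, the $r$-th square-free Hadamard product is $\mathbb{X}^{\underline{\star}r}=\{P_1\star\cdots\star P_r : P_i\in\mathbb{X},\ P_i\ne P_j\text{ for } i\neq j\}$. A collection of linear forms $\mathcal{L}=\{L_1,\dots,L_s\}\subset S_1$ is generally linear if any $t\le n$ of them have common zero locus of dimension $n-t$ and any $t>n$ of them have empty common zero locus in $\mathbb{P}^n$. For generally linear $\mathcal{L}$ and $1\le c\le n$, the codimension $c$ star configuration defined by $\mathcal{L}$ is $\mathbb{X}_c(\mathcal{L})=\bigcup_{1\le i_1<\dots<i_c\le s}V(L_{i_1},\dots,L_{i_c})$. $\mathcal{L}$ is a Hadamard set if there are a linear form $L\in S_1$ and points $P_1,\dots,P_s\in\mathbb{P}^n$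 with $V(L_i)=P_i\star V(L)$ for all $i$; it is a strong Hadamard set if moreover $P_i\in V(L)$ for all $i$. A star configuration $\mathbb{X}_c(\mathcal{L})$ is a Hadamard star configuration (HSC) if $\mathcal{L}$ is a strong Hadamard set. A set of points is said to be a (codimension $n$) HSC if it equals $\mathbb{X}_n(\mathcal{L})$ for some generally linear strong Hadamard set $\mathcal{L}$. *)

theory Defs
  imports
    Complex_Main
    "HOL-Library.Poly_Mapping"
    "Jordan_Normal_Form.Determinant"
    "Jordan_Normal_Form.VS_Connect"
begin

text \<open>
  A point of the projective space of dimension \<open>n\<close> is the class
  \<open>{c v | c \<noteq> 0}\<close> of a nonzero vector \<open>v\<close> with \<open>n + 1\<close> complex coordinates, indexed by
  \<open>0, ..., n\<close>; so equality of points is equality of sets.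
\<close>

type_synonym point = "complex vec set"

definition proj_pt :: "complex vec \<Rightarrow> point" where
  "proj_pt v = {c \<cdot>\<^sub>v v | c. c \<noteq> 0}"

definition proj_space :: "nat \<Rightarrow> point set" where
  "proj_space n = {proj_pt v | v. v \<in> carrier_vec (Suc n) \<and> v \<noteq> 0\<^sub>v (Suc n)}"


section \<open>Forms, zero loci and the Zariski closure\<close>

text \<open>
  A polynomial is a finitely supported map from monomials to coefficients, a monomial being a
  finitely supported map from (indices of) variables to exponents.
\<close>

type_synonym polynomial = "(nat \<Rightarrow>\<^sub>0 nat) \<Rightarrow>\<^sub>0 complex"

text \<open>The homogeneous part of degree \<open>d\<close> of \<open>S = \<complex>[x\<^sub>0, ..., x\<^sub>n]\<close> (including the zero polynomial).\<close>

definition forms :: "nat \<Rightarrow> nat \<Rightarrow> polynomial set" where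
  "forms n d = {F. \<forall>\<mu>\<in>Poly_Mapping.keys F.
      Poly_Mapping.keys \<mu> \<subseteq> {..n} \<and>
      (\<Sum>i\<in>Poly_Mapping.keys \<mu>. Poly_Mapping.lookup \<mu> i) = d}"

definition var :: "nat \<Rightarrow> polynomial" where
  "var i = Poly_Mapping.single (Poly_Mapping.single i 1) 1"

definition eval_poly_at :: "polynomial \<Rightarrow> complex vec \<Rightarrow> complex" where
  "eval_poly_at F v = (\<Sum>\<mu>\<in>Poly_Mapping.keys F. Poly_Mapping.lookup F \<mu> *
      (\<Prod>i\<in>Poly_Mapping.keys \<mu>. (v $ i) ^ Poly_Mapping.lookup \<mu> i))"

definition zero_locus :: "nat \<Rightarrow> polynomial set \<Rightarrow> point set" where
  "zero_locus n Fs = {A \<in> proj_space n. \<forall>F\<in>Fs. \<forall>v\<in>A. eval_poly_at F v = 0}"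

definition zariski_closed :: "nat \<Rightarrow> point set \<Rightarrow> bool" where
  "zariski_closed n Z \<longleftrightarrow> (\<exists>Fs. Fs \<subseteq> (\<Union>d. forms n d) \<and> Z = zero_locus n Fs)"

definition zariski_closure :: "nat \<Rightarrow> point set \<Rightarrow> point set" where
  "zariski_closure n Y = \<Inter>{Z. zariski_closed n Z \<and> Y \<subseteq> Z}"


section \<open>Linear subspaces and coordinate strata\<close>

text \<open>
  \<open>Z\<close> is a linear subvariety of dimension \<open>d\<close>: the projectivization of a linear subspace \<open>W\<close>
  of dimension \<open>d + 1\<close> of the space of vectors with \<open>n + 1\<close> coordinates.
\<close>

definition linear_subvariety :: "nat \<Rightarrow> nat \<Rightarrow> point set \<Rightarrow> bool" where
  "linear_subvariety n d Z \<longleftrightarrow>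
    (\<exists>W. subspace class_ring W (module_vec TYPE(complex) (Suc n)) \<and>
         vectorspace.dim class_ring
           ((module_vec TYPE(complex) (Suc n))\<lparr>carrier := W\<rparr>) = Suc d \<and>
         Z = {proj_pt v | v. v \<in> W \<and> v \<noteq> 0\<^sub>v (Suc n)})"

abbreviation line :: "nat \<Rightarrow> point set \<Rightarrow> bool" where
  "line n \<equiv> linear_subvariety n 1"

text \<open>
  The set of points with at most \<open>i + 1\<close> nonzero coordinates. The index is an integer, so that
  \<open>i = n - 2\<close> means \<open>-1\<close> (and gives the empty set) for \<open>n = 1\<close>.
\<close>

definition coord_stratum :: "nat \<Rightarrow> int \<Rightarrow> point set" where
  "coord_stratum n i =
    \<Union>{zero_locus n (var ` J) | J. J \<subseteq> {..n} \<and> int (card J) = int n - i}"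


section \<open>Hadamard products\<close>

definition hadamard_vec :: "complex vec \<Rightarrow> complex vec \<Rightarrow> complex vec" where
  "hadamard_vec a b = vec (dim_vec a) (\<lambda>i. a $ i * b $ i)"

text \<open>
  For \<open>A = [a]\<close> and \<open>B = [b]\<close> this is the class of the coordinatewise product of \<open>a\<close> and \<open>b\<close>. If
  that product vanishes, the result is \<open>{0}\<close>, which is not a point: the Hadamard product is then
  not defined.
\<close>

definition hadamard :: "point \<Rightarrow> point \<Rightarrow> point" (infixr \<open>\<star>\<close> 70) where
  "A \<star> B = {hadamard_vec a b | a b. a \<in> A \<and> b \<in> B}"

definition hadamard_variety :: "nat \<Rightarrow> point \<Rightarrow> point set \<Rightarrow> point set" where
  "hadamard_variety n A Y =
    zariski_closure n {A \<star> B | B. B \<in> Y \<and> A \<star> B \<in> proj_space n}"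

text \<open>
  The iterated product starts from the neutral element \<open>[1 : ... : 1]\<close>; as above, a product that
  is not defined is not in \<open>proj_space n\<close>.
\<close>

definition squarefree_hadamard_power :: "nat \<Rightarrow> nat \<Rightarrow> point set \<Rightarrow> point set" where
  "squarefree_hadamard_power n r X =
    {foldr (\<star>) As (proj_pt (vec (Suc n) (\<lambda>_. 1))) | As.
       length As = r \<and> set As \<subseteq> X \<and> distinct As} \<inter> proj_space n"


section \<open>Hadamard star configurations\<close>

definition generally_linear :: "nat \<Rightarrow> polynomial set \<Rightarrow> bool" where
  "generally_linear n \<L> \<longleftrightarrow> finite \<L> \<and> \<L> \<subseteq> forms n 1 \<and>
    (\<forall>T\<subseteq>\<L>. (card T \<le> n \<longrightarrow> linear_subvariety n (n - card T) (zero_locus n T)) \<and>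
            (card T > n \<longrightarrow> zero_locus n T = {}))"

definition star_configuration :: "nat \<Rightarrow> nat \<Rightarrow> polynomial set \<Rightarrow> point set" where
  "star_configuration n c \<L> = \<Union>{zero_locus n T | T. T \<subseteq> \<L> \<and> card T = c}"

definition strong_hadamard_set :: "nat \<Rightarrow> polynomial set \<Rightarrow> bool" where
  "strong_hadamard_set n \<L> \<longleftrightarrow> finite \<L> \<and> \<L> \<subseteq> forms n 1 \<and>
    (\<exists>L\<in>forms n 1. \<exists>P :: polynomial \<Rightarrow> point. \<forall>M\<in>\<L>.
       P M \<in> proj_space n \<and>
       zero_locus n {M} = hadamard_variety n (P M) (zero_locus n {L}) \<and>
       P M \<in> zero_locus n {L})"

definition hadamard_star_configuration :: "nat \<Rightarrow> nat \<Rightarrow> point set \<Rightarrow> bool" where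
  "hadamard_star_configuration n c Y \<longleftrightarrow> 1 \<le> c \<and> c \<le> n \<and>
    (\<exists>\<L>. generally_linear n \<L> \<and> strong_hadamard_set n \<L> \<and> Y = star_configuration n c \<L>)"


section \<open>The determinantal condition\<close>

text \<open>
  The first \<open>n\<close> rows are \<open>(p\<^sub>i\<^bsup>n-1-k\<^esup> q\<^sub>i\<^bsup>k\<^esup>)\<^sub>i\<close> for \<open>k = 0, ..., n - 1\<close>; the last row is \<open>r\<close>.
\<close>

definition power_matrix :: "nat \<Rightarrow> complex vec \<Rightarrow> complex vec \<Rightarrow> complex vec \<Rightarrow> complex mat" where
  "power_matrix n p q r = mat (Suc n) (Suc n)
    (\<lambda>(k, i). if k < n then (p $ i) ^ (n - 1 - k) * (q $ i) ^ k else r $ i)"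

end

theory Submission
  imports Defs
begin

text \<open>
  Let \<open>\<l>\<close> be spanned by \<open>p\<close> and \<open>q\<close>. The point of \<open>\<l>\<close> with parameters \<open>(s, t)\<close> has
  \<open>i\<close>-th coordinate \<open>s p\<^sub>i + t q\<^sub>i\<close>: the value of a binary linear form at \<open>z\<^sub>i = (p\<^sub>i, q\<^sub>i)\<close>. Since no
  point of \<open>\<l>\<close> has two zero coordinates, the \<open>n + 1\<close> vectors \<open>z\<^sub>i\<close> are pairwise non-parallel
  (\<open>line_through_two_points\<close>), so there is, up to scaling, exactly one nonzero family of weights
  \<open>a\<^sub>0, ..., a\<^sub>n\<close> with \<open>\<Sum>\<^sub>i a\<^sub>i F(z\<^sub>i) = 0\<close> for all binary forms \<open>F\<close> of degree \<open>n - 1\<close>, and no \<open>a\<^sub>i\<close>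
  vanishes (\<open>annihilator_nonvanishing\<close>). The two determinants vanish precisely when these weights
  also annihilate \<open>p\<close> and \<open>q\<close>, that is, when \<open>\<l>\<close> lies in the hyperplane of the linear form
  \<open>L = \<Sum>\<^sub>i a\<^sub>i x\<^sub>i\<close> (\<open>hyperplane_containing_line\<close>).

  The points \<open>A\<close> of \<open>X\<close> have no zero coordinate, so \<open>A \<star> V(L)\<close> is the hyperplane of
  \<open>L\<^sub>A = \<Sum>\<^sub>i (a\<^sub>i / A\<^sub>i) x\<^sub>i\<close>, and \<open>A \<in> \<l> \<subseteq> V(L)\<close>: the forms \<open>L\<^sub>A\<close> are a strong Hadamard set. Two facts
  identify their star configuration with the square-free power of \<open>X\<close>.

  First, the form \<open>L\<^sub>A\<close> vanishes at the product \<open>A \<star> A\<^sub>2 \<star> \<dots> \<star> A\<^sub>n\<close> for all points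
  \<open>A\<^sub>2, ..., A\<^sub>n\<close> of \<open>\<l>\<close>. Dividing by \<open>A\<^sub>i\<close> cancels the factor \<open>A\<close>, and what remains is the weighted
  sum of the values at the \<open>z\<^sub>i\<close> of a product of \<open>n - 1\<close> binary linear forms
  (\<open>annihilates_products\<close>). So the product of \<open>n\<close> points is a common zero of their \<open>n\<close> forms.

  Second, any \<open>n + 1\<close> of the forms \<open>L\<^sub>A\<close> are linearly independent. After rescaling the columns by
  the \<open>a\<^sub>i\<close>, their coefficient matrix is \<open>(1 / (s\<^sub>A p\<^sub>i + t\<^sub>A q\<^sub>i))\<close>, a Cauchy matrix in homogeneous
  parameters (\<open>cauchy_system_trivial\<close>). As \<open>X\<close> has more than \<open>n\<close> points, any smaller set of
  these forms extends to \<open>n + 1\<close> of them, which gives general linearity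
  (\<open>dim_common_kernel\<close>) and makes the common zero of \<open>n\<close> forms unique.
\<close>

section \<open>Cauchy systems and annihilators of binary forms\<close>

text \<open>
  Cauchy matrices with at least as many rows as columns have trivial kernel. One variable is
  eliminated with one equation. With \<open>l k i = s k * p i + t k * q i\<close>, the combination
  \<open>l k i0\<close> times equation \<open>k\<close> minus \<open>l k0 i0\<close> times equation \<open>k0\<close> does not contain \<open>y i0\<close>, and
  the two-by-two determinant identity
  \<open>l k i0 * l k0 i - l k0 i0 * l k i = (s k * t k0 - s k0 * t k) * (p i0 * q i - p i * q i0)\<close>
  shows that the remaining system is again of Cauchy type, in the rescaled unknowns
  \<open>y i * (p i0 * q i - p i * q i0) / l k0 i\<close>.
\<close>

lemma cauchy_system_trivial:
  fixes p q :: "'i \<Rightarrow> 'a :: field" and s t :: "'k \<Rightarrow> 'a"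
  assumes "finite I" and "finite K" and "card I \<le> card K"
    and "\<And>i j. i \<in> I \<Longrightarrow> j \<in> I \<Longrightarrow> i \<noteq> j \<Longrightarrow> p i * q j \<noteq> p j * q i"
    and "\<And>k l. k \<in> K \<Longrightarrow> l \<in> K \<Longrightarrow> k \<noteq> l \<Longrightarrow> s k * t l \<noteq> s l * t k"
    and "\<And>k i. k \<in> K \<Longrightarrow> i \<in> I \<Longrightarrow> s k * p i + t k * q i \<noteq> 0"
    and "\<And>k. k \<in> K \<Longrightarrow> (\<Sum>i\<in>I. y i / (s k * p i + t k * q i)) = 0"
  shows "\<forall>i\<in>I. y i = 0"
  using assms
proof (induction I arbitrary: K y rule: finite_induct)
  case (insert i0 I)
  then obtain k0 where k0: "k0 \<in> K" by fastforce
  define l where "l k i = s k * p i + t k * q i" for k i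
  have l: "l k i \<noteq> 0" if "k \<in> K" "i \<in> insert i0 I" for k i
    using insert.prems(5) that by (simp add: l_def)
  define z where "z i = y i * (p i0 * q i - p i * q i0) / l k0 i" for i
  have eq: "(\<Sum>i\<in>I. y i / l k i) = - y i0 / l k i0" if "k \<in> K" for k
    using insert.prems(6)[OF that] insert.hyps
    by (simp add: l_def eq_neg_iff_add_eq_0 add.commute)
  have "(\<Sum>i\<in>I. z i / l k i) = 0" if k: "k \<in> K - {k0}" for k
  proof -
    have id: "(s k * t k0 - s k0 * t k) * (z i / l k i)
        = l k i0 * (y i / l k i) - l k0 i0 * (y i / l k0 i)" if i: "i \<in> I" for i
    proof -
      have det: "(s k * t k0 - s k0 * t k) * (p i0 * q i - p i * q i0)
          = l k i0 * l k0 i - l k0 i0 * l k i"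
        by (simp add: l_def algebra_simps)
      have "(s k * t k0 - s k0 * t k) * (z i / l k i)
          = y i * ((s k * t k0 - s k0 * t k) * (p i0 * q i - p i * q i0)) / (l k0 i * l k i)"
        by (simp add: z_def mult_ac)
      also have "\<dots> = l k i0 * (y i / l k i) - l k0 i0 * (y i / l k0 i)"
        unfolding det using l[of k i] l[of k0 i] k k0 i by (simp add: field_simps)
      finally show ?thesis .
    qed
    have "(s k * t k0 - s k0 * t k) * (\<Sum>i\<in>I. z i / l k i)
        = l k i0 * (\<Sum>i\<in>I. y i / l k i) - l k0 i0 * (\<Sum>i\<in>I. y i / l k0 i)"
      unfolding sum_distrib_left sum_subtractf[symmetric] by (intro sum.cong refl id)
    also have "\<dots> = 0"
      using eq[of k] eq[of k0] k k0 l[of k i0] l[of k0 i0] by simp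
    finally show ?thesis
      using insert.prems(4)[of k k0] k k0 by simp
  qed
  then have "\<forall>i\<in>I. z i = 0"
    using insert.prems insert.hyps k0
    by (intro insert.IH[of "K - {k0}" z]) (simp_all add: l_def)
  moreover have "p i0 * q i \<noteq> p i * q i0" if "i \<in> I" for i
    using insert.prems(3)[of i0 i] insert.hyps(2) that by auto
  ultimately have I: "\<forall>i\<in>I. y i = 0"
    using l k0 by (auto simp: z_def)
  then have "y i0 = 0"
    using eq[OF k0] l[OF k0, of i0] by simp
  with I show ?case by simp
qed simp

text \<open>
  A product of \<open>d\<close> binary linear forms is a combination of the monomials of degree \<open>d\<close>. Instead
  of expanding it, the induction trades one linear factor for one more power of \<open>p i\<close> or \<open>q i\<close>,
  so the claim is generalised to a monomial times a product, of total degree \<open>d\<close>.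
\<close>

lemma annihilates_products:
  fixes a p q :: "'i \<Rightarrow> 'a :: comm_ring_1"
  assumes ann: "\<And>\<alpha> \<beta>. \<alpha> + \<beta> = d \<Longrightarrow> (\<Sum>i\<in>I. a i * (p i ^ \<alpha> * q i ^ \<beta>)) = 0"
    and "finite T" "card T = d"
  shows "(\<Sum>i\<in>I. a i * (\<Prod>k\<in>T. s k * p i + t k * q i)) = 0"
proof -
  have "(\<Sum>i\<in>I. a i * (p i ^ \<alpha> * q i ^ \<beta> * (\<Prod>k\<in>T. s k * p i + t k * q i))) = 0"
    if "\<alpha> + \<beta> + card T = d" for \<alpha> \<beta>
    using \<open>finite T\<close> that
  proof (induction T arbitrary: \<alpha> \<beta> rule: finite_induct)
    case (insert k T)
    have "(\<Sum>i\<in>I. a i * (p i ^ \<alpha> * q i ^ \<beta> * (\<Prod>k\<in>insert k T. s k * p i + t k * q i)))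
      = s k * (\<Sum>i\<in>I. a i * (p i ^ Suc \<alpha> * q i ^ \<beta> * (\<Prod>k\<in>T. s k * p i + t k * q i)))
      + t k * (\<Sum>i\<in>I. a i * (p i ^ \<alpha> * q i ^ Suc \<beta> * (\<Prod>k\<in>T. s k * p i + t k * q i)))"
      unfolding sum_distrib_left sum.distrib[symmetric] using insert.hyps
      by (intro sum.cong refl) (simp add: algebra_simps)
    also have "\<dots> = 0"
      using insert.IH[of "Suc \<alpha>" \<beta>] insert.IH[of \<alpha> "Suc \<beta>"] insert.prems insert.hyps by simp
    finally show ?case .
  qed (use ann in simp)
  from this[of 0 0] assms(3) show ?thesis by simp
qed

text \<open>
  Applied to the product of the \<open>d\<close> linear forms that each vanish at one of the vectors other than
  the \<open>i\<close>-th and the \<open>j\<close>-th, the relation leaves only \<open>a i\<close> and \<open>a j\<close>, with nonzero factors. So a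
  nonzero relation has no zero weight, and two relations are proportional: subtracting a suitable
  multiple of one from the other makes a weight zero.
\<close>

lemma annihilator_nonvanishing:
  fixes a p q :: "'i \<Rightarrow> 'a :: field"
  assumes ann: "\<And>\<alpha> \<beta>. \<alpha> + \<beta> = d \<Longrightarrow> (\<Sum>i\<in>I. a i * (p i ^ \<alpha> * q i ^ \<beta>)) = 0"
    and I: "finite I" "card I = d + 2"
    and np: "\<And>i j. i \<in> I \<Longrightarrow> j \<in> I \<Longrightarrow> i \<noteq> j \<Longrightarrow> p i * q j \<noteq> p j * q i"
    and j: "j \<in> I" "a j = 0"
  shows "\<forall>i\<in>I. a i = 0"
proof
  fix i assume i: "i \<in> I"
  show "a i = 0"
  proof (cases "i = j")
    case False
    let ?T = "I - {i, j}"
    have "card ?T = d"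
      using I i j False by (simp add: card_Diff_subset)
    then have "0 = (\<Sum>m\<in>I. a m * (\<Prod>k\<in>?T. q k * p m + (- p k) * q m))"
      using annihilates_products[OF ann, where T = ?T and s = q and t = "\<lambda>k. - p k"] I by simp
    also have "\<dots> = (\<Sum>m\<in>{i}. a m * (\<Prod>k\<in>?T. q k * p m + (- p k) * q m))"
    proof (rule sum.mono_neutral_right)
      show "\<forall>m\<in>I - {i}. a m * (\<Prod>k\<in>?T. q k * p m + (- p k) * q m) = 0"
      proof
        fix m assume m: "m \<in> I - {i}"
        show "a m * (\<Prod>k\<in>?T. q k * p m + (- p k) * q m) = 0"
        proof (cases "m = j")
          case False
          then have "(\<Prod>k\<in>?T. q k * p m + (- p k) * q m) = 0"
            using m I by (intro prod_zero) (auto intro!: bexI[of _ m])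
          then show ?thesis by simp
        qed (use j in simp)
      qed
    qed (use i I in auto)
    finally have "a i * (\<Prod>k\<in>?T. q k * p i - p k * q i) = 0" by simp
    moreover have "(\<Prod>k\<in>?T. q k * p i - p k * q i) \<noteq> 0"
      using np[OF i] I by (auto simp: mult.commute)
    ultimately show ?thesis by simp
  qed (use j in simp)
qed

section \<open>Dimensions of subspaces of coordinate space\<close>

text \<open>
  The dimension of a vector space is defined as a least cardinality, which says something only
  once a finite generating set is known to exist; a maximal linearly independent subset of \<open>W\<close>
  provides one.
\<close>

lemma (in vec_space) subspace_fin_dim:
  assumes "subspace class_ring W V"
  shows "vectorspace.fin_dim class_ring (vs W)"
proof -
  interpret W: vectorspace class_ring "vs W"
    using assms by (rule subspace_is_vs)
  have sub: "submodule class_ring W V"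
    using assms by (simp add: subspace_def)
  have WC: "W \<subseteq> carrier_vec n"
    using submodule.subset[OF sub] by simp
  have indpt: "W.lin_indpt S = lin_indpt S" if "S \<subseteq> W" for S
    using span_li_not_depend(2)[OF that sub] by simp
  let ?P = "\<lambda>S. S \<subseteq> W \<and> W.lin_indpt S"
  have bounded: "finite S \<and> card S \<le> n" if "?P S" for S
    using that indpt[of S] WC li_le_dim[OF fin_dim, of S] dim_is_n by auto
  have "?P {}"
    by (simp add: W.lin_dep_def)
  then obtain S where S: "finite S" "maximal S ?P"
    using maximal_exists[of ?P n "{}"] bounded by blast
  then have "W.basis S"
    using W.max_li_is_basis[of S] by simp
  with S(1) show ?thesis
    by (auto simp: W.fin_dim_def W.basis_def)
qed

lemma (in vec_space) dim2_span_pair: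
  assumes W: "subspace class_ring W V" and dim2: "vectorspace.dim class_ring (vs W) = 2"
    and pq: "p \<in> W" "q \<in> W"
    and indep: "\<And>s t. s \<cdot>\<^sub>v p + t \<cdot>\<^sub>v q = 0\<^sub>v n \<Longrightarrow> s = 0 \<and> t = 0"
    and v: "v \<in> W"
  shows "\<exists>s t. v = s \<cdot>\<^sub>v p + t \<cdot>\<^sub>v q"
proof -
  interpret W: vectorspace class_ring "vs W"
    using W by (rule subspace_is_vs)
  have sub: "submodule class_ring W V"
    using W by (simp add: subspace_def)
  have WC: "W \<subseteq> carrier_vec n"
    using submodule.subset[OF sub] by simp
  have ne: "p \<noteq> q"
  proof
    assume "p = q"
    then have "1 \<cdot>\<^sub>v p + (-1) \<cdot>\<^sub>v q = 0\<^sub>v n"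
      using pq WC by (intro eq_vecI) auto
    from indep[OF this] show False by simp
  qed
  have C: "p \<in> carrier_vec n" "q \<in> carrier_vec n"
    using pq WC by auto
  have lc: "lincomb c {p, q} = c p \<cdot>\<^sub>v p + c q \<cdot>\<^sub>v q" for c
  proof (rule eq_vecI)
    show "dim_vec (lincomb c {p, q}) = dim_vec (c p \<cdot>\<^sub>v p + c q \<cdot>\<^sub>v q)"
      using lincomb_dim[of "{p, q}" c] C by simp
    fix i assume "i < dim_vec (c p \<cdot>\<^sub>v p + c q \<cdot>\<^sub>v q)"
    then have "i < n" using carrier_vecD[OF C(2)] by simp
    then have "lincomb c {p, q} $ i = c p * p $ i + c q * q $ i"
      using lincomb_index[of i "{p, q}" c] C ne by simp
    with \<open>i < n\<close> show "lincomb c {p, q} $ i = (c p \<cdot>\<^sub>v p + c q \<cdot>\<^sub>v q) $ i"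
      using carrier_vecD[OF C(1)] carrier_vecD[OF C(2)] by simp
  qed
  have "lin_indpt {p, q}"
  proof (rule finite_lin_indpt2)
    fix c assume "lincomb c {p, q} = 0\<^sub>v n"
    then have "c p \<cdot>\<^sub>v p + c q \<cdot>\<^sub>v q = 0\<^sub>v n"
      unfolding lc .
    from indep[OF this] show "\<forall>v\<in>{p, q}. c v = 0"
      by simp
  qed (use C in simp_all)
  then have "W.lin_indpt {p, q}"
    using span_li_not_depend(2)[OF _ sub, of "{p, q}"] pq by simp
  then have "W.basis {p, q}"
    using dim2 pq ne subspace_fin_dim[OF W] by (intro W.dim_li_is_basis) auto
  then have "v \<in> W.span {p, q}"
    using v by (simp add: W.basis_def)
  then have "v \<in> span {p, q}"
    using span_li_not_depend(1)[OF _ sub, of "{p, q}"] pq by simp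
  then obtain c where "v = lincomb c {p, q}"
    using finite_span[of "{p, q}"] pq WC by auto
  then show ?thesis
    using lc by blast
qed

text \<open>
  If \<open>N\<close> linear forms on an \<open>N\<close>-dimensional space have only the trivial common zero, then the
  square system that they define is solvable for every right-hand side. Hence evaluation of the
  forms in a subset \<open>T\<close> is onto, and rank-nullity gives the dimension of its kernel.
\<close>

lemma dim_common_kernel:
  fixes c :: "'k \<Rightarrow> nat \<Rightarrow> 'a :: field"
  assumes K: "finite K" "card K = N" "T \<subseteq> K"
    and trivial: "\<And>x. x \<in> carrier_vec N \<Longrightarrow> \<forall>k\<in>K. (\<Sum>i<N. c k i * x $ i) = 0 \<Longrightarrow> x = 0\<^sub>v N"
  defines "W \<equiv> {x \<in> carrier_vec N. \<forall>k\<in>T. (\<Sum>i<N. c k i * x $ i) = 0}"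
  shows "subspace class_ring W (module_vec TYPE('a) N)"
    and "vectorspace.dim class_ring ((module_vec TYPE('a) N)\<lparr>carrier := W\<rparr>) = N - card T"
proof -
  have finT: "finite T" using K finite_subset by blast
  obtain e where e: "bij_betw e {..<card T} T"
    using ex_bij_betw_nat_finite[OF finT] by (auto simp: atLeast0LessThan)
  obtain d where d: "bij_betw d {..<N} K"
    using ex_bij_betw_nat_finite[OF K(1)] K(2) by (auto simp: atLeast0LessThan)
  define f where "f x = vec (card T) (\<lambda>j. \<Sum>i<N. c (e j) i * x $ i)" for x :: "'a vec"
  interpret D: vec_space "TYPE('a)" N .
  interpret R: vec_space "TYPE('a)" "card T" .
  have f_closed: "f x \<in> carrier_vec (card T)" for x
    by (simp add: f_def)
  have f_add: "f (x + y) = f x + f y" if "x \<in> carrier_vec N" "y \<in> carrier_vec N" for x y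
    unfolding f_def using that
    by (intro eq_vecI) (simp_all add: sum.distrib[symmetric] distrib_left[symmetric])
  have f_smult: "f (s \<cdot>\<^sub>v x) = s \<cdot>\<^sub>v f x" if "x \<in> carrier_vec N" for s x
    unfolding f_def using that
    by (intro eq_vecI) (simp_all add: sum_distrib_left mult.left_commute)
  have "mod_hom class_ring (module_vec TYPE('a) N) (module_vec TYPE('a) (card T)) f"
  proof (intro mod_hom.intro mod_hom_axioms.intro vec_module)
    show "f \<in> LinearCombinations.module_hom class_ring (module_vec TYPE('a) N) (module_vec TYPE('a) (card T))"
      unfolding LinearCombinations.module_hom_def module_vec_simps mem_Collect_eq
      using f_add f_smult f_closed by blast
  qed
  then interpret f: linear_map class_ring "module_vec TYPE('a) N" "module_vec TYPE('a) (card T)" f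
    by (intro linear_map.intro vec_vs)
  have "f x = 0\<^sub>v (card T) \<longleftrightarrow> (\<forall>k\<in>e ` {..<card T}. (\<Sum>i<N. c k i * x $ i) = 0)" for x
    by (auto simp: f_def vec_eq_iff)
  then have "f x = 0\<^sub>v (card T) \<longleftrightarrow> (\<forall>k\<in>T. (\<Sum>i<N. c k i * x $ i) = 0)" for x
    using bij_betw_imp_surj_on[OF e] by simp
  then have ker: "f.kerT = W"
    unfolding f.ker_def W_def module_vec_simps by blast
  show "subspace class_ring W (module_vec TYPE('a) N)"
    using f.kerT_is_subspace unfolding ker .
  have surj: "f ` carrier_vec N = carrier_vec (card T)"
  proof (intro equalityI subsetI)
    fix y :: "'a vec" assume y: "y \<in> carrier_vec (card T)"
    define A where "A = mat N N (\<lambda>(j, i). c (d j) i)"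
    have A: "A \<in> carrier_mat N N" by (simp add: A_def)
    have Ax: "(A *\<^sub>v x) $ j = (\<Sum>i<N. c (d j) i * x $ i)"
      if "x \<in> carrier_vec N" "j < N" for x j
      using that by (auto simp: A_def scalar_prod_def atLeast0LessThan intro!: sum.cong)
    have "det A \<noteq> 0"
    proof
      assume "det A = 0"
      then obtain x where x: "x \<in> carrier_vec N" "x \<noteq> 0\<^sub>v N" "A *\<^sub>v x = 0\<^sub>v N"
        using det_0_iff_vec_prod_zero[OF A] by auto
      have "(\<Sum>i<N. c k i * x $ i) = 0" if "k \<in> K" for k
        using that Ax[OF x(1)] x(3) bij_betw_imp_surj_on[OF d] by fastforce
      with trivial[OF x(1)] x(2) show False by blast
    qed
    then obtain B where B: "B \<in> carrier_mat N N" "A * B = 1\<^sub>m N"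
      using det_non_zero_imp_unit[OF A, of "()"] by (auto simp: Units_def ring_mat_def)
    \<comment> \<open>Prescribe the values of \<open>y\<close> for the forms in \<open>T\<close> and \<open>0\<close> for the others.\<close>
    define z where "z = vec N (\<lambda>j. if d j \<in> T then y $ the_inv_into {..<card T} e (d j) else 0)"
    have "A *\<^sub>v (B *\<^sub>v z) = z"
      using A B by (simp flip: assoc_mult_mat_vec add: z_def)
    moreover have Bz: "B *\<^sub>v z \<in> carrier_vec N"
      using B by (simp add: z_def)
    ultimately have sol: "(\<Sum>i<N. c (d j) i * (B *\<^sub>v z) $ i) = z $ j" if "j < N" for j
      using Ax[of "B *\<^sub>v z" j] that by simp
    have "f (B *\<^sub>v z) = y"
    proof (rule eq_vecI)
      fix k assume "k < dim_vec y"
      then have k: "k < card T" using y by simp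
      then have "e k \<in> K" using bij_betwE[OF e] K by auto
      then obtain j where j: "j < N" "d j = e k"
        using bij_betw_imp_surj_on[OF d] by force
      have "e k \<in> T" using bij_betwE[OF e] k by auto
      with j k show "f (B *\<^sub>v z) $ k = y $ k"
        using sol[of j] the_inv_into_f_f[OF bij_betw_imp_inj_on[OF e], of k]
        by (simp add: f_def z_def)
    qed (use y in \<open>simp add: f_def\<close>)
    with Bz show "y \<in> f ` carrier_vec N" by blast
  qed (auto simp: f_def)
  have "f.imT = carrier_vec (card T)"
    using surj unfolding f.im_def module_vec_simps .
  then show "vectorspace.dim class_ring ((module_vec TYPE('a) N)\<lparr>carrier := W\<rparr>) = N - card T"
    using f.rank_nullity[OF D.fin_dim] ker D.dim_is_n R.dim_is_n
    by (simp add: module_vec_def)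
qed

section \<open>Projective points, hyperplanes and Hadamard products\<close>

lemma self_in_proj_pt: "v \<in> proj_pt v"
  unfolding proj_pt_def by (auto intro!: exI[of _ 1] eq_vecI)

lemma proj_pt_smult:
  assumes "c \<noteq> 0" shows "proj_pt (c \<cdot>\<^sub>v v) = proj_pt v"
proof -
  have "\<exists>d. e \<cdot>\<^sub>v v = d \<cdot>\<^sub>v (c \<cdot>\<^sub>v v) \<and> d \<noteq> 0" if "e \<noteq> 0" for e
    using assms that by (intro exI[of _ "e / c"]) (simp add: smult_smult_assoc)
  moreover have "\<exists>d'. d \<cdot>\<^sub>v (c \<cdot>\<^sub>v v) = d' \<cdot>\<^sub>v v \<and> d' \<noteq> 0" if "d \<noteq> 0" for d
    using assms that by (intro exI[of _ "d * c"]) (simp add: smult_smult_assoc)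
  ultimately show ?thesis
    unfolding proj_pt_def by blast
qed

lemma proj_pt_eqD: "proj_pt u = proj_pt v \<Longrightarrow> \<exists>c. c \<noteq> 0 \<and> u = c \<cdot>\<^sub>v v"
  using self_in_proj_pt[of u] unfolding proj_pt_def by blast

definition linear_form :: "nat \<Rightarrow> (nat \<Rightarrow> complex) \<Rightarrow> polynomial" where
  "linear_form n a = (\<Sum>i\<le>n. Poly_Mapping.single (Poly_Mapping.single i 1) (a i))"

lemma single_one_inj: "(Poly_Mapping.single i (1::nat) = Poly_Mapping.single j 1) = (i = j)"
  by (metis lookup_single_eq lookup_single_not_eq zero_neq_one)

lemma lookup_linear_form:
  assumes "i \<le> n"
  shows "Poly_Mapping.lookup (linear_form n a) (Poly_Mapping.single i 1) = a i"
proof -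
  have "Poly_Mapping.lookup (linear_form n a) (Poly_Mapping.single i 1)
      = (\<Sum>j\<le>n. if j = i then a j else 0)"
    unfolding linear_form_def lookup_sum lookup_single single_one_inj when_def ..
  then show ?thesis using assms by simp
qed

lemma keys_linear_form:
  "Poly_Mapping.keys (linear_form n a) \<subseteq> (\<lambda>i. Poly_Mapping.single i 1) ` {..n}"
proof
  fix \<mu> assume "\<mu> \<in> Poly_Mapping.keys (linear_form n a)"
  then have "(\<Sum>i\<le>n. Poly_Mapping.lookup
      (Poly_Mapping.single (Poly_Mapping.single i (1::nat)) (a i)) \<mu>) \<noteq> 0"
    by (simp add: linear_form_def lookup_sum in_keys_iff)
  then obtain i where "i \<le> n"
    "Poly_Mapping.lookup (Poly_Mapping.single (Poly_Mapping.single i (1::nat)) (a i)) \<mu> \<noteq> 0"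
    by (meson atMost_iff sum.neutral)
  then show "\<mu> \<in> (\<lambda>i. Poly_Mapping.single i 1) ` {..n}"
    by (auto simp: lookup_single when_def split: if_splits)
qed

lemma linear_form_in_forms: "linear_form n a \<in> forms n 1"
  using keys_linear_form[of n a] by (fastforce simp: forms_def)

lemma eval_linear_form: "eval_poly_at (linear_form n a) v = (\<Sum>i\<le>n. a i * v $ i)"
proof -
  let ?t = "\<lambda>\<mu>. Poly_Mapping.lookup (linear_form n a) \<mu> *
      (\<Prod>i\<in>Poly_Mapping.keys \<mu>. (v $ i) ^ Poly_Mapping.lookup \<mu> i)"
  have "eval_poly_at (linear_form n a) v
      = sum ?t ((\<lambda>i. Poly_Mapping.single i 1) ` {..n})"
    unfolding eval_poly_at_def
    by (rule sum.mono_neutral_left) (use keys_linear_form in \<open>auto simp: in_keys_iff\<close>)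
  also have "\<dots> = (\<Sum>i\<le>n. ?t (Poly_Mapping.single i 1))"
    by (subst sum.reindex) (auto simp: inj_on_def single_one_inj simp del: One_nat_def)
  also have "\<dots> = (\<Sum>i\<le>n. a i * v $ i)"
    by (intro sum.cong) (auto simp: lookup_linear_form simp del: One_nat_def)
  finally show ?thesis .
qed

text \<open>
  With this, the coordinate strata are covered by the description of zero loci of linear forms.
\<close>

lemma var_eq_linear_form:
  assumes "j \<le> n" shows "var j = linear_form n (\<lambda>i. if i = j then 1 else 0)"
proof -
  have "linear_form n (\<lambda>i. if i = j then 1 else 0) 
     = (\<Sum>i\<le>n. if i = j then Poly_Mapping.single (Poly_Mapping.single i 1) 1 else 0)"
    unfolding linear_form_def by (intro sum.cong) auto
  then show ?thesis using assms by (simp add: var_def)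
qed

text \<open>
  Linear forms are homogeneous, so vanishing at one representative of a point is vanishing at all
  of them; common zero loci of linear forms become solution sets of linear systems.
\<close>

lemma zero_locus_linear_forms:
  "zero_locus n ((\<lambda>k. linear_form n (c k)) ` T) =
     {proj_pt v | v. v \<in> carrier_vec (Suc n) \<and> v \<noteq> 0\<^sub>v (Suc n) \<and>
        (\<forall>k\<in>T. (\<Sum>i\<le>n. c k i * v $ i) = 0)}"
proof -
  have "(\<forall>w\<in>proj_pt v. eval_poly_at (linear_form n a) w = 0) \<longleftrightarrow> (\<Sum>i\<le>n. a i * v $ i) = 0"
    if v: "v \<in> carrier_vec (Suc n)" for v a
  proof
    assume "(\<Sum>i\<le>n. a i * v $ i) = 0"
    moreover have "eval_poly_at (linear_form n a) (d \<cdot>\<^sub>v v) = d * (\<Sum>i\<le>n. a i * v $ i)" for d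
      unfolding eval_linear_form sum_distrib_left using v by (intro sum.cong) auto
    ultimately show "\<forall>w\<in>proj_pt v. eval_poly_at (linear_form n a) w = 0"
      by (auto simp: proj_pt_def)
  qed (use self_in_proj_pt[of v] eval_linear_form in metis)
  then show ?thesis
    unfolding zero_locus_def proj_space_def ball_simps by blast
qed

lemma coord_stratumI:
  assumes "v \<in> carrier_vec (Suc n)" "v \<noteq> 0\<^sub>v (Suc n)"
    and "J \<subseteq> {..n}" "int (card J) = int n - i" and "\<forall>j\<in>J. v $ j = 0"
  shows "proj_pt v \<in> coord_stratum n i"
proof -
  have var: "var ` J = (\<lambda>j. linear_form n (\<lambda>i. if i = j then 1 else 0)) ` J"
    using assms(3) by (intro image_cong) (auto intro: var_eq_linear_form)
  have "\<forall>j\<in>J. (\<Sum>i\<le>n. (if i = j then 1 else 0) * v $ i) = 0"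
    using assms(5) by (intro ballI sum.neutral) auto
  then have "proj_pt v \<in> zero_locus n (var ` J)"
    unfolding var zero_locus_linear_forms mem_Collect_eq using assms(1,2) by (intro exI[of _ v]) simp
  then show ?thesis
    using assms(3,4) unfolding coord_stratum_def by blast
qed

lemma hadamard_proj_pt:
  assumes "dim_vec a = dim_vec b"
  shows "proj_pt a \<star> proj_pt b = proj_pt (hadamard_vec a b)"
proof -
  have prod: "hadamard_vec (c \<cdot>\<^sub>v a) (d \<cdot>\<^sub>v b) = (c * d) \<cdot>\<^sub>v hadamard_vec a b" for c d
    using assms by (intro eq_vecI) (auto simp: hadamard_vec_def)
  have "\<exists>u w. e \<cdot>\<^sub>v hadamard_vec a b = hadamard_vec u w \<and> u \<in> proj_pt a \<and> w \<in> proj_pt b"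
    if "e \<noteq> 0" for e
    using prod[of e 1] that unfolding proj_pt_def
    by (intro exI[of _ "e \<cdot>\<^sub>v a"] exI[of _ "1 \<cdot>\<^sub>v b"]) (auto intro: exI[of _ "1::complex"])
  then show ?thesis
    unfolding hadamard_def by (auto simp: proj_pt_def prod)
qed

lemma zariski_closure_zero_locus:
  assumes "Fs \<subseteq> (\<Union>d. forms n d)"
  shows "zariski_closure n (zero_locus n Fs) = zero_locus n Fs"
  using assms unfolding zariski_closure_def zariski_closed_def by blast

text \<open>
  Multiplication by a point without zero coordinates is a bijection of projective space which maps
  hyperplanes onto hyperplanes; so the image is already closed, and taking the closure adds nothing.
\<close>

lemma hadamard_variety_hyperplane:
  assumes u: "u \<in> carrier_vec (Suc n)" "\<And>i. i \<le> n \<Longrightarrow> u $ i \<noteq> 0"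
  shows "hadamard_variety n (proj_pt u) (zero_locus n {linear_form n a})
      = zero_locus n {linear_form n (\<lambda>i. a i / u $ i)}"
proof -
  have hyperplane: "zero_locus n {linear_form n b} = {proj_pt v | v. v \<in> carrier_vec (Suc n) \<and>
      v \<noteq> 0\<^sub>v (Suc n) \<and> (\<Sum>i\<le>n. b i * v $ i) = 0}" for b
    using zero_locus_linear_forms[of n "\<lambda>_. b" "{()}"] by simp
  have "{proj_pt u \<star> B | B. B \<in> zero_locus n {linear_form n a} \<and> proj_pt u \<star> B \<in> proj_space n}
      = zero_locus n {linear_form n (\<lambda>i. a i / u $ i)}" (is "?A = ?B")
  proof (intro equalityI subsetI)
    fix X assume "X \<in> ?A"
    then obtain v where v: "v \<in> carrier_vec (Suc n)" "v \<noteq> 0\<^sub>v (Suc n)" 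
      "(\<Sum>i\<le>n. a i * v $ i) = 0" "X = proj_pt (hadamard_vec u v)"
      using u(1) unfolding hyperplane by (auto simp: hadamard_proj_pt)
    have "hadamard_vec u v \<noteq> 0\<^sub>v (Suc n)"
    proof
      assume 0: "hadamard_vec u v = 0\<^sub>v (Suc n)"
      have "v $ i = 0" if "i < Suc n" for i
        using arg_cong[OF 0, of "\<lambda>x. x $ i"] that u by (simp add: hadamard_vec_def)
      then have "v = 0\<^sub>v (Suc n)"
        using v(1) by (intro eq_vecI) auto
      with v(2) show False ..
    qed
    moreover have "(\<Sum>i\<le>n. a i / u $ i * hadamard_vec u v $ i) = (\<Sum>i\<le>n. a i * v $ i)"
      using u by (intro sum.cong) (auto simp: hadamard_vec_def)
    ultimately show "X \<in> ?B"
      unfolding hyperplane using v u by (auto simp: hadamard_vec_def intro!: exI[of _ "hadamard_vec u v"])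
  next
    fix X assume "X \<in> ?B"
    then obtain v where v: "v \<in> carrier_vec (Suc n)" "v \<noteq> 0\<^sub>v (Suc n)" 
      "(\<Sum>i\<le>n. a i / u $ i * v $ i) = 0" "X = proj_pt v"
      unfolding hyperplane by auto
    \<comment> \<open>Coordinatewise division by \<open>u\<close> inverts the product with \<open>u\<close>.\<close>
    define w where "w = vec (Suc n) (\<lambda>i. v $ i / u $ i)"
    have w: "w \<in> carrier_vec (Suc n)" by (simp add: w_def)
    have uw: "hadamard_vec u w = v"
      using u v(1) by (intro eq_vecI) (auto simp: hadamard_vec_def w_def)
    have "w \<noteq> 0\<^sub>v (Suc n)"
    proof
      assume "w = 0\<^sub>v (Suc n)"
      with uw have "v = 0\<^sub>v (Suc n)"
        using u(1) by (intro eq_vecI) (auto simp: hadamard_vec_def)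
      with v(2) show False ..
    qed
    moreover have "(\<Sum>i\<le>n. a i * w $ i) = (\<Sum>i\<le>n. a i / u $ i * v $ i)"
      by (intro sum.cong) (auto simp: w_def)
    ultimately have "proj_pt w \<in> zero_locus n {linear_form n a}"
      unfolding hyperplane using v(3) w by auto
    moreover have "proj_pt u \<star> proj_pt w = X"
      using u(1) w v(4) uw by (simp add: hadamard_proj_pt)
    moreover have "X \<in> proj_space n"
      using v by (auto simp: proj_space_def)
    ultimately show "X \<in> ?A" by blast
  qed
  moreover have "{linear_form n (\<lambda>i. a i / u $ i)} \<subseteq> (\<Union>d. forms n d)"
    using linear_form_in_forms by blast
  ultimately show ?thesis
    unfolding hadamard_variety_def by (simp add: zariski_closure_zero_locus)
qed

lemma foldr_hadamard:
  assumes "distinct As"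
    and "\<And>A. A \<in> set As \<Longrightarrow> r A \<in> carrier_vec N \<and> proj_pt (r A) = A"
  shows "foldr (\<star>) As (proj_pt (vec N (\<lambda>_. 1))) = proj_pt (vec N (\<lambda>i. \<Prod>A\<in>set As. r A $ i))"
  using assms
proof (induction As)
  case (Cons A As)
  have "foldr (\<star>) (A # As) (proj_pt (vec N (\<lambda>_. 1)))
      = proj_pt (r A) \<star> proj_pt (vec N (\<lambda>i. \<Prod>A\<in>set As. r A $ i))"
    using Cons by simp
  also have "\<dots> = proj_pt (hadamard_vec (r A) (vec N (\<lambda>i. \<Prod>A\<in>set As. r A $ i)))"
    using Cons.prems(2)[of A] by (intro hadamard_proj_pt) simp
  also have "hadamard_vec (r A) (vec N (\<lambda>i. \<Prod>A\<in>set As. r A $ i))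
      = vec N (\<lambda>i. \<Prod>A\<in>set (A # As). r A $ i)"
    using Cons.prems by (intro eq_vecI) (fastforce simp: hadamard_vec_def)+
  finally show ?case .
next
  case Nil
  show ?case by simp
qed

section \<open>The line and its hyperplane\<close>

text \<open>
  If the \<open>i\<close>-th and \<open>j\<close>-th columns of the matrix with rows \<open>p\<close> and \<open>q\<close> were
  parallel, a nontrivial combination of \<open>p\<close> and \<open>q\<close> would vanish in both coordinates and be a
  point of the line in the forbidden stratum.
\<close>

lemma line_through_two_points:
  assumes line: "line n \<l>" and avoid: "\<l> \<inter> coord_stratum n (int n - 2) = {}"
    and p: "p \<in> carrier_vec (Suc n)" "p \<noteq> 0\<^sub>v (Suc n)" "proj_pt p \<in> \<l>"
    and q: "q \<in> carrier_vec (Suc n)" "q \<noteq> 0\<^sub>v (Suc n)" "proj_pt q \<in> \<l>"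
    and ne: "proj_pt p \<noteq> proj_pt q"
  shows "\<And>i j. i \<le> n \<Longrightarrow> j \<le> n \<Longrightarrow> i \<noteq> j \<Longrightarrow> p $ i * q $ j \<noteq> p $ j * q $ i"
    and "\<And>A. A \<in> \<l> \<Longrightarrow> \<exists>s t. A = proj_pt (s \<cdot>\<^sub>v p + t \<cdot>\<^sub>v q) \<and> s \<cdot>\<^sub>v p + t \<cdot>\<^sub>v q \<noteq> 0\<^sub>v (Suc n)"
proof -
  interpret vec_space "TYPE(complex)" "Suc n" .
  obtain W where W: "subspace class_ring W V" "vectorspace.dim class_ring (vs W) = 2"
    and l: "\<l> = {proj_pt v | v. v \<in> W \<and> v \<noteq> 0\<^sub>v (Suc n)}"
    using line unfolding linear_subvariety_def by auto
  have sub: "submodule class_ring W V"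
    using W(1) by (simp add: subspace_def)
  have smult: "c \<cdot>\<^sub>v v \<in> W" if "v \<in> W" for c v
    using submodule.smult_closed[OF sub _ that, of c] by (simp add: module_vec_simps class_ring_simps)
  have add: "v + w \<in> W" if "v \<in> W" "w \<in> W" for v w
    using submodule.m_closed[OF sub that] by (simp add: module_vec_simps)
  have mem: "v \<in> W" if "proj_pt v \<in> \<l>" for v
    using that smult unfolding l by (auto dest!: proj_pt_eqD)
  have pW: "p \<in> W" and qW: "q \<in> W"
    using mem p(3) q(3) by auto
  have indep: "s = 0 \<and> t = 0" if st: "s \<cdot>\<^sub>v p + t \<cdot>\<^sub>v q = 0\<^sub>v (Suc n)" for s t
  proof (rule ccontr)
    have i: "s * p $ i + t * q $ i = 0" if "i \<le> n" for i
      using arg_cong[OF st, of "\<lambda>x. x $ i"] that p(1) q(1) by simp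
    assume "\<not> (s = 0 \<and> t = 0)"
    moreover have "s \<noteq> 0" if t: "t \<noteq> 0"
    proof
      assume "s = 0"
      then have "q = 0\<^sub>v (Suc n)"
        using i t q(1) by (intro eq_vecI) auto
      with q(2) show False ..
    qed
    moreover have "t \<noteq> 0" if s: "s \<noteq> 0"
    proof
      assume "t = 0"
      then have "p = 0\<^sub>v (Suc n)"
        using i s p(1) by (intro eq_vecI) auto
      with p(2) show False ..
    qed
    ultimately have "s \<noteq> 0" "t \<noteq> 0" by blast+
    have "p = (- t / s) \<cdot>\<^sub>v q"
    proof (rule eq_vecI)
      fix j assume "j < dim_vec ((- t / s) \<cdot>\<^sub>v q)"
      then have "j \<le> n" using q(1) by simp
      from i[OF this] have "s * p $ j = - t * q $ j"
        by (simp add: eq_neg_iff_add_eq_0)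
      then show "p $ j = ((- t / s) \<cdot>\<^sub>v q) $ j"
        using \<open>s \<noteq> 0\<close> \<open>j \<le> n\<close> q(1) by (simp add: field_simps)
    qed (use p(1) q(1) in simp)
    then have "proj_pt p = proj_pt q"
      using proj_pt_smult[of "- t / s" q] \<open>s \<noteq> 0\<close> \<open>t \<noteq> 0\<close> by simp
    with ne show False ..
  qed
  show "\<exists>s t. A = proj_pt (s \<cdot>\<^sub>v p + t \<cdot>\<^sub>v q) \<and> s \<cdot>\<^sub>v p + t \<cdot>\<^sub>v q \<noteq> 0\<^sub>v (Suc n)" if A: "A \<in> \<l>" for A
  proof -
    obtain v where v: "v \<in> W" "v \<noteq> 0\<^sub>v (Suc n)" "A = proj_pt v"
      using A unfolding l by blast
    with dim2_span_pair[OF W pW qW indep v(1)] show ?thesis by blast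
  qed
  show "p $ i * q $ j \<noteq> p $ j * q $ i" if ij: "i \<le> n" "j \<le> n" "i \<noteq> j" for i j
  proof
    assume par: "p $ i * q $ j = p $ j * q $ i"
    have "\<exists>s t. (s \<noteq> 0 \<or> t \<noteq> 0) \<and> s * p $ i + t * q $ i = 0 \<and> s * p $ j + t * q $ j = 0"
    proof (cases "p $ i = 0 \<and> q $ i = 0")
      case True
      moreover have "\<exists>s t. (s \<noteq> 0 \<or> t \<noteq> 0) \<and> s * p $ j + t * q $ j = 0"
      proof (cases "q $ j = 0")
        case True
        then show ?thesis by (intro exI[of _ 0] exI[of _ 1]) simp
      next
        case False
        then show ?thesis by (intro exI[of _ "q $ j"] exI[of _ "- p $ j"]) simp
      qed
      ultimately show ?thesis by simp
    next
      case False
      then show ?thesis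
        using par by (intro exI[of _ "q $ i"] exI[of _ "- p $ i"]) (auto simp: mult.commute)
    qed
    then obtain s t where st: "s \<noteq> 0 \<or> t \<noteq> 0" "s * p $ i + t * q $ i = 0" "s * p $ j + t * q $ j = 0"
      by blast
    let ?v = "s \<cdot>\<^sub>v p + t \<cdot>\<^sub>v q"
    have v: "?v \<in> carrier_vec (Suc n)" "?v \<noteq> 0\<^sub>v (Suc n)"
      using p(1) q(1) indep st(1) by auto
    have "proj_pt ?v \<in> coord_stratum n (int n - 2)"
      using v ij st(2,3) p(1) q(1) by (intro coord_stratumI[of _ _ "{i, j}"]) auto
    moreover have "proj_pt ?v \<in> \<l>"
      unfolding l using v add[OF smult[OF pW] smult[OF qW]] by blast
    ultimately show False using avoid by blast
  qed
qed

text \<open>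
  A kernel vector of the power matrix with last row \<open>r\<close> is an annihilator of the binary forms of
  degree \<open>n - 1\<close> that is also orthogonal to \<open>r\<close>. The kernel vectors obtained for \<open>r = p\<close> and
  \<open>r = q\<close> are proportional, as the annihilator is unique up to scaling, so the first of them is
  orthogonal to both points.
\<close>

lemma hyperplane_containing_line:
  assumes n: "1 \<le> n" and p: "p \<in> carrier_vec (Suc n)" and q: "q \<in> carrier_vec (Suc n)"
    and np: "\<And>i j. i \<le> n \<Longrightarrow> j \<le> n \<Longrightarrow> i \<noteq> j \<Longrightarrow> p $ i * q $ j \<noteq> p $ j * q $ i"
    and det: "det (power_matrix n p q p) = 0" "det (power_matrix n p q q) = 0"
  shows "\<exists>a. (\<forall>i\<le>n. a i \<noteq> 0) \<and> (\<Sum>i\<le>n. a i * p $ i) = 0 \<and> (\<Sum>i\<le>n. a i * q $ i) = 0 \<and>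
    (\<forall>\<alpha> \<beta>. \<alpha> + \<beta> = n - 1 \<longrightarrow> (\<Sum>i\<le>n. a i * (p $ i ^ \<alpha> * q $ i ^ \<beta>)) = 0)"
proof -
  define ann where "ann a \<longleftrightarrow>
    (\<forall>\<alpha> \<beta>. \<alpha> + \<beta> = n - 1 \<longrightarrow> (\<Sum>i\<le>n. a i * (p $ i ^ \<alpha> * q $ i ^ \<beta>)) = 0)" for a
  have ann0: "\<forall>i\<in>{..n}. a i = 0" if "ann a" "j \<le> n" "a j = 0" for a j
    by (rule annihilator_nonvanishing[where d = "n - 1" and p = "\<lambda>i. p $ i" and q = "\<lambda>i. q $ i" and j = j])
      (use that n np in \<open>auto simp: ann_def\<close>)
  have kernel: "\<exists>a. ann a \<and> (\<Sum>i\<le>n. a i * r $ i) = 0 \<and> (\<forall>i\<le>n. a i \<noteq> 0)"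
    if det_r: "det (power_matrix n p q r) = 0" for r
  proof -
    let ?M = "power_matrix n p q r"
    have M: "?M \<in> carrier_mat (Suc n) (Suc n)"
      by (simp add: power_matrix_def)
    then obtain v where v: "v \<in> carrier_vec (Suc n)" "v \<noteq> 0\<^sub>v (Suc n)" "?M *\<^sub>v v = 0\<^sub>v (Suc n)"
      using det_r det_0_iff_vec_prod_zero[OF M] by auto
    have row: "(\<Sum>i\<le>n. v $ i * ?M $$ (k, i)) = 0" if "k \<le> n" for k
    proof -
      have "(?M *\<^sub>v v) $ k = (\<Sum>i\<le>n. v $ i * ?M $$ (k, i))"
        using that v(1) M by (auto simp: scalar_prod_def lessThan_Suc_atMost atLeast0LessThan
            mult.commute intro!: sum.cong)
      then show ?thesis using v(3) that by simp
    qed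
    have "ann (\<lambda>i. v $ i)"
      unfolding ann_def
    proof (intro allI impI)
      fix \<alpha> \<beta> assume "\<alpha> + \<beta> = n - 1"
      then have \<beta>: "\<beta> < n" and \<alpha>: "\<alpha> = n - 1 - \<beta>" using n by auto
      have "(\<Sum>i\<le>n. v $ i * (p $ i ^ \<alpha> * q $ i ^ \<beta>)) = (\<Sum>i\<le>n. v $ i * ?M $$ (\<beta>, i))"
        using \<beta> by (intro sum.cong) (auto simp: power_matrix_def \<alpha>)
      then show "(\<Sum>i\<le>n. v $ i * (p $ i ^ \<alpha> * q $ i ^ \<beta>)) = 0"
        using row[of \<beta>] \<beta> by simp
    qed
    moreover have "(\<Sum>i\<le>n. v $ i * r $ i) = 0"
    proof -
      have "(\<Sum>i\<le>n. v $ i * r $ i) = (\<Sum>i\<le>n. v $ i * ?M $$ (n, i))"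
        by (intro sum.cong) (auto simp: power_matrix_def)
      then show ?thesis using row[of n] by simp
    qed
    moreover have "v $ i \<noteq> 0" if "i \<le> n" for i
    proof
      assume "v $ i = 0"
      then have "v = 0\<^sub>v (Suc n)"
        using ann0[OF \<open>ann (\<lambda>i. v $ i)\<close> that] v(1) by (intro eq_vecI) auto
      with v(2) show False ..
    qed
    ultimately show ?thesis by (intro exI[of _ "\<lambda>i. v $ i"]) simp
  qed
  obtain a where a: "ann a" "(\<Sum>i\<le>n. a i * p $ i) = 0" "\<forall>i\<le>n. a i \<noteq> 0"
    using kernel[OF det(1)] by blast
  obtain b where b: "ann b" "(\<Sum>i\<le>n. b i * q $ i) = 0" "\<forall>i\<le>n. b i \<noteq> 0"
    using kernel[OF det(2)] by blast
  \<comment> \<open>This combination vanishes at index \<open>0\<close>, so it vanishes altogether.\<close>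
  have "ann (\<lambda>i. a 0 * b i - b 0 * a i)"
    using a(1) b(1) unfolding ann_def left_diff_distrib sum_subtractf mult.assoc sum_distrib_left[symmetric]
    by simp
  then have multiple: "a 0 * b i = b 0 * a i" if "i \<le> n" for i
    using ann0[of _ 0] that by fastforce
  have "b 0 * (\<Sum>i\<le>n. a i * q $ i) = a 0 * (\<Sum>i\<le>n. b i * q $ i)"
    unfolding sum_distrib_left mult.assoc[symmetric] using multiple by (intro sum.cong) auto
  then have "(\<Sum>i\<le>n. a i * q $ i) = 0"
    using b by simp
  with a show ?thesis unfolding ann_def by blast
qed

section \<open>The star configuration\<close>

text \<open>
  The theorem in coordinates: \<open>u A\<close> is the representative of \<open>A\<close> with parameters
  \<open>(s A, t A)\<close>, and \<open>a\<close> are the weights found in the previous lemma. The forms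
  \<open>L A = \<Sum>\<^sub>i (a\<^sub>i / (u A)\<^sub>i) x\<^sub>i\<close> define the star configuration.
\<close>

lemma hadamard_powers_of_points_on_line:
  fixes n :: nat and p q a :: "nat \<Rightarrow> complex" and s t :: "point \<Rightarrow> complex"
  defines "u \<equiv> \<lambda>A. vec (Suc n) (\<lambda>i. s A * p i + t A * q i)"
  assumes n: "1 \<le> n" and X: "finite X" "n < card X"
    and np: "\<And>i j. i \<le> n \<Longrightarrow> j \<le> n \<Longrightarrow> i \<noteq> j \<Longrightarrow> p i * q j \<noteq> p j * q i"
    and a: "\<And>i. i \<le> n \<Longrightarrow> a i \<noteq> 0" "(\<Sum>i\<le>n. a i * p i) = 0" "(\<Sum>i\<le>n. a i * q i) = 0"
    and ann: "\<And>\<alpha> \<beta>. \<alpha> + \<beta> = n - 1 \<Longrightarrow> (\<Sum>i\<le>n. a i * (p i ^ \<alpha> * q i ^ \<beta>)) = 0"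
    and u_pt: "\<And>A. A \<in> X \<Longrightarrow> proj_pt (u A) = A"
    and u_nz: "\<And>A i. A \<in> X \<Longrightarrow> i \<le> n \<Longrightarrow> u A $ i \<noteq> 0"
  shows "hadamard_star_configuration n n (squarefree_hadamard_power n n X)"
proof -
  have uC: "u A \<in> carrier_vec (Suc n)" for A by (simp add: u_def)
  have ui: "u A $ i = s A * p i + t A * q i" if "i \<le> n" for A i
    using that by (simp add: u_def)
  define c where "c A i = a i / u A $ i" for A i
  define L where "L A = linear_form n (c A)" for A
  define ev where "ev A x = (\<Sum>i\<le>n. c A i * x $ i)" for A x
  define w where "w Y = vec (Suc n) (\<lambda>i. \<Prod>A\<in>Y. u A $ i)" for Y
  have zl: "zero_locus n (L ` Y) = {proj_pt v | v. v \<in> carrier_vec (Suc n) \<and> v \<noteq> 0\<^sub>v (Suc n) \<and>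
      (\<forall>A\<in>Y. ev A v = 0)}" for Y
    unfolding L_def zero_locus_linear_forms ev_def ..

  \<comment> \<open>Points with parallel parameters have proportional coordinates, so they coincide.\<close>
  have st_np: "s A * t B \<noteq> s B * t A" if AB: "A \<in> X" "B \<in> X" "A \<noteq> B" for A B
  proof
    assume eq: "s A * t B = s B * t A"
    have "u A $ 0 * u B $ i = u B $ 0 * u A $ i" if "i \<le> n" for i
    proof -
      have "u A $ 0 * u B $ i - u B $ 0 * u A $ i = (s A * t B - s B * t A) * (p 0 * q i - q 0 * p i)"
        using that by (simp add: ui algebra_simps)
      with eq show ?thesis by simp
    qed
    then have "u A = (u A $ 0 / u B $ 0) \<cdot>\<^sub>v u B"
      using u_nz[OF AB(2), of 0] uC by (intro eq_vecI) (auto simp: u_def field_simps)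
    then have "proj_pt (u A) = proj_pt (u B)"
      using proj_pt_smult[of "u A $ 0 / u B $ 0" "u B"] u_nz AB by simp
    with AB u_pt show False by simp
  qed

  have trivial: "x = 0\<^sub>v (Suc n)"
    if K: "K \<subseteq> X" "card K = Suc n" and x: "x \<in> carrier_vec (Suc n)" "\<forall>A\<in>K. ev A x = 0" for K x
  proof -
    have "\<forall>i\<in>{..n}. a i * x $ i = 0"
    proof (rule cauchy_system_trivial[of "{..n}" K p q s t])
      show "s A * t B \<noteq> s B * t A" if "A \<in> K" "B \<in> K" "A \<noteq> B" for A B
        using st_np[of A B] that K by blast
      show "finite K" using K X finite_subset by blast
      show "s A * p i + t A * q i \<noteq> 0" if "A \<in> K" "i \<in> {..n}" for A i
        using u_nz[of A i] ui[of i A] that K by auto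
      show "(\<Sum>i\<le>n. a i * x $ i / (s A * p i + t A * q i)) = 0" if "A \<in> K" for A
      proof -
        have "(\<Sum>i\<le>n. a i * x $ i / (s A * p i + t A * q i)) = ev A x"
          unfolding ev_def c_def by (intro sum.cong) (auto simp: ui)
        with x that show ?thesis by simp
      qed
    qed (use K np in auto)
    then show ?thesis
      using a(1) x(1) by (intro eq_vecI) auto
  qed
  have extend: "\<exists>K. Y \<subseteq> K \<and> K \<subseteq> X \<and> card K = Suc n" if "Y \<subseteq> X" "card Y \<le> Suc n" for Y
    using exists_subset_between[OF that(2) _ that(1) X(1)] X(2) by auto

  have inj: "inj_on L X"
  proof (rule inj_onI)
    fix A B assume AB: "A \<in> X" "B \<in> X" "L A = L B"
    have "u A $ i = u B $ i" if "i \<le> n" for i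
    proof -
      have "c A i = c B i"
        using lookup_linear_form[OF that, of "c A"] lookup_linear_form[OF that, of "c B"] AB(3)
        by (simp add: L_def)
      then show ?thesis
        using a(1)[OF that] u_nz[OF AB(1) that] u_nz[OF AB(2) that] by (simp add: c_def field_simps)
    qed
    then have "u A = u B"
      using uC by (intro eq_vecI) (auto simp: u_def)
    with AB u_pt show "A = B" by metis
  qed

  have subsets: "\<exists>Y. Y \<subseteq> X \<and> T = L ` Y \<and> card T = card Y" if "T \<subseteq> L ` X" for T
    using that inj by (metis card_image inj_on_subset subset_image_iff)

  have forms: "L ` X \<subseteq> forms n 1"
    using linear_form_in_forms by (auto simp: L_def)

  have general: "generally_linear n (L ` X)"
    unfolding generally_linear_def
  proof (intro conjI allI impI)
    fix T assume T: "T \<subseteq> L ` X"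
    then obtain Y where Y: "Y \<subseteq> X" "T = L ` Y" "card T = card Y"
      using subsets by blast
    show "linear_subvariety n (n - card T) (zero_locus n T)" if small: "card T \<le> n"
    proof -
      obtain K where K: "Y \<subseteq> K" "K \<subseteq> X" "card K = Suc n"
        using extend[OF Y(1)] small Y(3) by auto
      have finK: "finite K" using K X finite_subset by blast
      have triv: "x = 0\<^sub>v (Suc n)"
        if "x \<in> carrier_vec (Suc n)" "\<forall>k\<in>K. (\<Sum>i<Suc n. c k i * x $ i) = 0" for x
        using trivial[OF K(2,3) that(1)] that(2) unfolding ev_def lessThan_Suc_atMost by blast
      let ?W = "{x \<in> carrier_vec (Suc n). \<forall>A\<in>Y. ev A x = 0}"
      have "subspace class_ring ?W (module_vec TYPE(complex) (Suc n))"
        and "vectorspace.dim class_ring ((module_vec TYPE(complex) (Suc n))\<lparr>carrier := ?W\<rparr>)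
          = Suc (n - card T)"
        using dim_common_kernel[OF finK K(3,1) triv] small Y(3)
        unfolding ev_def lessThan_Suc_atMost by (simp_all add: Suc_diff_le)
      moreover have "zero_locus n T = {proj_pt v | v. v \<in> ?W \<and> v \<noteq> 0\<^sub>v (Suc n)}"
        unfolding Y(2) zl by blast
      ultimately show ?thesis
        unfolding linear_subvariety_def by blast
    qed
    show "zero_locus n T = {}" if "n < card T"
    proof -
      obtain K where K: "K \<subseteq> Y" "card K = Suc n"
        using obtain_subset_with_card_n[of "Suc n" Y] \<open>n < card T\<close> Y(3) by auto
      then show ?thesis
        unfolding Y(2) zl using trivial[of K] Y(1) by blast
    qed
  qed (use X forms in auto)

  have "strong_hadamard_set n (L ` X)"
    unfolding strong_hadamard_set_def
  proof (intro conjI bexI[of _ "linear_form n a"] exI[of _ "the_inv_into X L"] ballI)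
    fix M assume "M \<in> L ` X"
    then obtain A where A: "A \<in> X" "M = L A" by blast
    have inv: "the_inv_into X L M = A"
      using A inj by (simp add: the_inv_into_f_f)
    have nz: "u A \<noteq> 0\<^sub>v (Suc n)"
      using u_nz[OF A(1), of 0] by auto
    show "the_inv_into X L M \<in> proj_space n"
      unfolding inv proj_space_def using uC nz u_pt[OF A(1)] by blast
    have "hadamard_variety n (proj_pt (u A)) (zero_locus n {linear_form n a})
        = zero_locus n {linear_form n (\<lambda>i. a i / u A $ i)}"
      using u_nz[OF A(1)] uC by (intro hadamard_variety_hyperplane)
    then show "zero_locus n {M} = hadamard_variety n (the_inv_into X L M) (zero_locus n {linear_form n a})"
      unfolding inv u_pt[OF A(1)] by (simp add: A(2) L_def c_def[abs_def])
    have "(\<Sum>i\<le>n. a i * u A $ i) = s A * (\<Sum>i\<le>n. a i * p i) + t A * (\<Sum>i\<le>n. a i * q i)"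
      unfolding sum_distrib_left sum.distrib[symmetric]
      by (intro sum.cong) (auto simp: ui algebra_simps)
    then have "(\<Sum>i\<le>n. a i * u A $ i) = 0"
      using a(2,3) by simp
    then have "proj_pt (u A) \<in> zero_locus n {linear_form n a}"
      using zero_locus_linear_forms[of n "\<lambda>_. a" "{()}"] uC nz by auto
    then show "the_inv_into X L M \<in> zero_locus n {linear_form n a}"
      unfolding inv u_pt[OF A(1)] .
  qed (use X forms linear_form_in_forms in auto)

  moreover have vertex: "zero_locus n (L ` Y) = {proj_pt (w Y)}" if Y: "Y \<subseteq> X" "card Y = n" for Y
  proof -
    have finY: "finite Y" using Y X finite_subset by blast
    have wC: "w Y \<in> carrier_vec (Suc n)" by (simp add: w_def)
    have "w Y $ 0 \<noteq> 0"
      using Y u_nz finY by (auto simp: w_def)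
    then have wnz: "w Y \<noteq> 0\<^sub>v (Suc n)" by auto
    have w0: "ev A (w Y) = 0" if A: "A \<in> Y" for A
    proof -
      \<comment> \<open>The factor \<open>u A\<close> of the product cancels the denominator of \<open>c A\<close>.\<close>
      have "ev A (w Y) = (\<Sum>i\<le>n. a i * (\<Prod>B\<in>Y - {A}. s B * p i + t B * q i))"
        unfolding ev_def
      proof (rule sum.cong)
        fix i assume i: "i \<in> {..n}"
        have "w Y $ i = u A $ i * (\<Prod>B\<in>Y - {A}. u B $ i)"
          using i prod.remove[OF finY A, of "\<lambda>B. u B $ i"] by (simp add: w_def)
        then show "c A i * w Y $ i = a i * (\<Prod>B\<in>Y - {A}. s B * p i + t B * q i)"
          using i u_nz[of A i] Y(1) A by (auto simp: c_def ui)
      qed simp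
      also have "\<dots> = 0"
        using annihilates_products[OF ann, where T = "Y - {A}" and s = s and t = t] A finY Y(2) by simp
      finally show ?thesis .
    qed
    have "proj_pt x = proj_pt (w Y)"
      if x: "x \<in> carrier_vec (Suc n)" "x \<noteq> 0\<^sub>v (Suc n)" "\<forall>A\<in>Y. ev A x = 0" for x
    proof -
      obtain B where B: "B \<in> X" "B \<notin> Y"
        using X(2) Y by (metis less_irrefl subset_antisym subsetI)
      have K: "insert B Y \<subseteq> X" "card (insert B Y) = Suc n"
        using B Y finY by auto
      have evw: "ev B (w Y) \<noteq> 0"
        using trivial[OF K wC] wnz w0 by auto
      have evx: "ev B x \<noteq> 0"
        using trivial[OF K x(1)] x(2,3) by auto
      \<comment> \<open>A combination of two zeros of the forms of \<open>Y\<close> that is killed by one further form.\<close>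
      define y where "y = ev B (w Y) \<cdot>\<^sub>v x - ev B x \<cdot>\<^sub>v w Y"
      have yC: "y \<in> carrier_vec (Suc n)"
        using x(1) wC by (simp add: y_def)
      have "ev A y = ev B (w Y) * ev A x - ev B x * ev A (w Y)" for A
        unfolding ev_def[of A] sum_distrib_left sum_subtractf[symmetric]
        using x(1) wC by (intro sum.cong) (auto simp: y_def algebra_simps)
      then have "\<forall>A\<in>insert B Y. ev A y = 0"
        using w0 x(3) by simp
      then have y0: "y = 0\<^sub>v (Suc n)"
        by (rule trivial[OF K yC])
      have "x = (ev B x / ev B (w Y)) \<cdot>\<^sub>v w Y"
      proof (rule eq_vecI)
        fix i assume "i < dim_vec ((ev B x / ev B (w Y)) \<cdot>\<^sub>v w Y)"
        then have i: "i < Suc n" using wC by simp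
        have "ev B (w Y) * x $ i = ev B x * w Y $ i"
          using arg_cong[OF y0, of "\<lambda>v. v $ i"] i x(1) wC by (simp add: y_def)
        then show "x $ i = ((ev B x / ev B (w Y)) \<cdot>\<^sub>v w Y) $ i"
          using evw i wC by (simp add: field_simps)
      qed (use x(1) wC in simp)
      then show ?thesis
        using proj_pt_smult[of "ev B x / ev B (w Y)" "w Y"] evw evx by simp
    qed
    then show ?thesis
      unfolding zl using wC wnz w0 by blast
  qed

  have star: "star_configuration n n (L ` X) = {proj_pt (w Y) | Y. Y \<subseteq> X \<and> card Y = n}"
  proof (intro equalityI subsetI)
    fix x assume "x \<in> star_configuration n n (L ` X)"
    then obtain T where T: "T \<subseteq> L ` X" "card T = n" "x \<in> zero_locus n T"
      unfolding star_configuration_def by blast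
    then obtain Y where "Y \<subseteq> X" "T = L ` Y" "card Y = n"
      using subsets by metis
    with T vertex show "x \<in> {proj_pt (w Y) | Y. Y \<subseteq> X \<and> card Y = n}" by blast
  next
    fix x assume "x \<in> {proj_pt (w Y) | Y. Y \<subseteq> X \<and> card Y = n}"
    then obtain Y where Y: "Y \<subseteq> X" "card Y = n" "x = proj_pt (w Y)" by blast
    then have "card (L ` Y) = n"
      using inj by (metis card_image inj_on_subset)
    with Y vertex[OF Y(1,2)] show "x \<in> star_configuration n n (L ` X)"
      unfolding star_configuration_def by blast
  qed

  have prod: "foldr (\<star>) As (proj_pt (vec (Suc n) (\<lambda>_. 1))) = proj_pt (w (set As))"
    if "distinct As" "set As \<subseteq> X" for As
    unfolding w_def using that uC u_pt by (intro foldr_hadamard) auto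
  have w_space: "proj_pt (w Y) \<in> proj_space n" if Y: "Y \<subseteq> X" "card Y = n" for Y
    using vertex[OF Y] unfolding zero_locus_def by auto
  have power: "squarefree_hadamard_power n n X = {proj_pt (w Y) | Y. Y \<subseteq> X \<and> card Y = n}"
  proof (intro equalityI subsetI)
    fix x assume "x \<in> squarefree_hadamard_power n n X"
    then obtain As where "length As = n" "set As \<subseteq> X" "distinct As"
      "x = foldr (\<star>) As (proj_pt (vec (Suc n) (\<lambda>_. 1)))"
      unfolding squarefree_hadamard_power_def by blast
    with prod[of As] show "x \<in> {proj_pt (w Y) | Y. Y \<subseteq> X \<and> card Y = n}"
      by (auto simp: distinct_card intro!: exI[of _ "set As"])
  next
    fix x assume "x \<in> {proj_pt (w Y) | Y. Y \<subseteq> X \<and> card Y = n}"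
    then obtain Y where Y: "Y \<subseteq> X" "card Y = n" "x = proj_pt (w Y)" by blast
    obtain As where As: "set As = Y" "distinct As"
      using finite_distinct_list Y(1) X(1) finite_subset by metis
    with prod[of As] Y w_space[OF Y(1,2)] distinct_card[OF As(2)]
    show "x \<in> squarefree_hadamard_power n n X"
      unfolding squarefree_hadamard_power_def by (metis (mono_tags, lifting) IntI mem_Collect_eq)
  qed
  show ?thesis
    unfolding hadamard_star_configuration_def
    using n general calculation star power by auto
qed

theorem theorem4p12:
  fixes n m :: nat and \<l> X :: "point set"
  assumes "line n \<l>"
    and "\<l> \<inter> coord_stratum n (int n - 2) = {}"
    and "X \<subseteq> \<l>" and "finite X" and "card X = m" and "m > n"
    and "X \<inter> coord_stratum n (int n - 1) = {}"
    and "\<exists>p\<in>carrier_vec (Suc n). \<exists>q\<in>carrier_vec (Suc n).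
           p \<noteq> 0\<^sub>v (Suc n) \<and> q \<noteq> 0\<^sub>v (Suc n) \<and>
           proj_pt p \<in> \<l> \<and> proj_pt q \<in> \<l> \<and> proj_pt p \<noteq> proj_pt q \<and>
           det (power_matrix n p q p) = 0 \<and> det (power_matrix n p q q) = 0"
  shows "hadamard_star_configuration n n (squarefree_hadamard_power n n X)"
proof -
  obtain p q where p: "p \<in> carrier_vec (Suc n)" "p \<noteq> 0\<^sub>v (Suc n)" "proj_pt p \<in> \<l>"
    and q: "q \<in> carrier_vec (Suc n)" "q \<noteq> 0\<^sub>v (Suc n)" "proj_pt q \<in> \<l>"
    and ne: "proj_pt p \<noteq> proj_pt q"
    and det: "det (power_matrix n p q p) = 0" "det (power_matrix n p q q) = 0"
    using assms(8) by blast
  note np = line_through_two_points(1)[OF assms(1,2) p q ne]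
  note span = line_through_two_points(2)[OF assms(1,2) p q ne]
  \<comment> \<open>In dimension \<open>0\<close> there is only one point, while \<open>p\<close> and \<open>q\<close> represent different ones.\<close>
  have n: "1 \<le> n"
  proof (rule ccontr)
    assume "\<not> 1 \<le> n"
    then have [simp]: "n = 0" by simp
    have p0: "p $ 0 \<noteq> 0" and q0: "q $ 0 \<noteq> 0"
      using p(1,2) q(1,2) by (auto simp: vec_eq_iff)
    then have "p = (p $ 0 / q $ 0) \<cdot>\<^sub>v q"
      using p(1) q(1) by (intro eq_vecI) auto
    then show False
      using proj_pt_smult[of "p $ 0 / q $ 0" q] p0 q0 ne by simp
  qed
  obtain a where a: "\<forall>i\<le>n. a i \<noteq> 0" "(\<Sum>i\<le>n. a i * p $ i) = 0" "(\<Sum>i\<le>n. a i * q $ i) = 0"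
    "\<forall>\<alpha> \<beta>. \<alpha> + \<beta> = n - 1 \<longrightarrow> (\<Sum>i\<le>n. a i * (p $ i ^ \<alpha> * q $ i ^ \<beta>)) = 0"
    using hyperplane_containing_line[OF n p(1) q(1) np det] by blast
  have "\<forall>A\<in>X. \<exists>st. A = proj_pt (fst st \<cdot>\<^sub>v p + snd st \<cdot>\<^sub>v q) \<and>
      fst st \<cdot>\<^sub>v p + snd st \<cdot>\<^sub>v q \<noteq> 0\<^sub>v (Suc n)"
    using span assms(3) by fastforce
  then obtain st where st: "\<forall>A\<in>X. A = proj_pt (fst (st A) \<cdot>\<^sub>v p + snd (st A) \<cdot>\<^sub>v q) \<and>
      fst (st A) \<cdot>\<^sub>v p + snd (st A) \<cdot>\<^sub>v q \<noteq> 0\<^sub>v (Suc n)"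
    by metis
  define u where "u A = vec (Suc n) (\<lambda>i. fst (st A) * p $ i + snd (st A) * q $ i)" for A
  have "u A = fst (st A) \<cdot>\<^sub>v p + snd (st A) \<cdot>\<^sub>v q" for A
    using p(1) q(1) by (intro eq_vecI) (auto simp: u_def)
  then have u: "proj_pt (u A) = A" "u A \<noteq> 0\<^sub>v (Suc n)" if "A \<in> X" for A
    using st that by auto
  have u_nz: "u A $ i \<noteq> 0" if "A \<in> X" "i \<le> n" for A i
  proof
    assume "u A $ i = 0"
    then have "proj_pt (u A) \<in> coord_stratum n (int n - 1)"
      using u(2)[OF that(1)] that(2) by (intro coord_stratumI[of _ _ "{i}"]) (auto simp: u_def)
    with u(1) that(1) assms(7) show False by auto
  qed
  show ?thesis
    using n assms(4,5,6) np a u(1) u_nz unfolding u_def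
    by (intro hadamard_powers_of_points_on_line[where p = "\<lambda>i. p $ i" and q = "\<lambda>i. q $ i"
          and s = "\<lambda>A. fst (st A)" and t = "\<lambda>A. snd (st A)" and a = a]) auto
qed

end
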